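(* Fix positive integers $r,n$, let $O=\{o_1,\ldots,o_r\}$ and $V=\{v_1,\ldots,v_n\}$ be disjoint sets of labeled vertices, let $\Delta$ be a region of the $r$-Shi arrangement $\mathcal{S}_n^r$ and ${\bm x}\in\Delta$, and form $p_j,q_j,f,F,T_{\bm x}$ as described in the context. Then this construction is well defined: in case (ii) the minimal positive entry of $\mathrm{col}_j(C_{\bm x})$ is unique, and the recursion defining $f$ terminates. Moreover, $T_{\bm x}$ is an $O$-rooted labeled $r$-tree on $O\cup V$ that does not depend on the choice of ${\bm x}\in\Delta$. Finally, the map \[\Psi_n^r:\mathcal{R}(\mathcal{S}_n^r)\to\mathcal{T}_n^r,\qquad \Psi_n^r(\Delta)=T_{\bm x}\ (\text{for any }{\bm x}\in\Delta)\] is a bijection.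
   Context: The $r$-Shi arrangement $\mathcal{S}_n^r$ in $\mathbb{R}^n$ is the set of hyperplanes $x_i-x_j=a$ for $1\le i<j\le n$ and $a\in\{-r+1,-r+2,\ldots,0,1,\ldots,r\}$. A region is a connected component of the complement of the union of these hyperplanes, and $\mathcal{R}(\mathcal{S}_n^r)$ denotes the set of regions. For ${\bm x}=(x_1,\ldots,x_n)\in\mathbb{R}^n$, the cubic matrix $C_{\bm x}=(c_{ijk}({\bm x}))$, with $i,j\in[n]$ and $k\in[r]$, is defined by - $c_{ijk}({\bm x})=x_i-x_j-k$ if $i<j$; - $c_{ijk}({\bm x})=0$ if $i=j$; - $c_{ijk}({\bm x})=x_i-x_j-k+1$ if $i>j$. The $j$-th column slice $\mathrm{col}_j(C_{\bm x})$ is the family $(c_{ijk}({\bm x}))_{i\in[n],k\in[r]}$. For each $j\in[n]$, define $f(v_j)=(f_1(v_j),\ldots,f_r(v_j))\in(O\cup V)^r$ recursively: - (i) if all entries of $\mathrm{col}_j(C_{\bm x})$ are $\le 0$, put $p_j=0$ and $f(v_j)=(o_1,\ldots,o_r)$; - (ii) otherwise $\mathrm{col}_j(C_{\bm x})$ has a minimal positive entry at a position $(p_j,q_j)\in[n]\times[r]$, i.e. $c_{p_jjq_j}({\bm x})$ is the smallest positive value among the $c_{ijk}({\bm x})$, and then \[f(v_j)=\big(f_1(v_{p_j}),\ldots,f_{q_j-1}(v_{p_j}),f_{q_j+1}(v_{p_j}),\ldots,f_r(v_{p_j}),v_{p_j}\big).\] Let $F(v_j)=\{f_i(v_j): i\in[r]\}$.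 The graph $T_{\bm x}$ on vertex set $O\cup V$ has as edges exactly those needed so that, for every $j\in[n]$, $v_j$ together with the vertices of $F(v_j)$ forms an $(r+1)$-clique. An $O$-rooted labeled $r$-tree on $O\cup V$ is a graph $T$ on $O\cup V$ admitting a rearrangement $(v_{i_1},\ldots,v_{i_n})$ of $v_1,\ldots,v_n$ (a valid rearrangement) with the following property: for each $j\in[n]$, $v_{i_j}$ is adjacent to exactly $r$ vertices of $\{o_1,\ldots,o_r,v_{i_1},\ldots,v_{i_{j-1}}\}$, and these $r$ vertices are mutually adjacent in $T$. $\mathcal{T}_n^r$ denotes the set of all such graphs. *)

theory Defs
  imports "HOL-Analysis.Analysis"
begin

text \<open>
  The index set \<open>[n]\<close> is a finite linearly ordered type \<open>'n\<close> with \<open>n = CARD('n)\<close>, so that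
  \<open>\<real>\<^sup>n\<close> is \<^typ>\<open>real ^ 'n\<close>. The index set \<open>[r]\<close> is \<^term>\<open>{1..r}\<close>.
\<close>

definition shi_arrangement :: "nat \<Rightarrow> (real ^ 'n::{finite,linorder}) set set" where
  "shi_arrangement r =
     {{x. x $ i - x $ j = of_int a} | i j a. i < j \<and> a \<in> {- int r + 1..int r}}"

definition shi_regions :: "nat \<Rightarrow> (real ^ 'n::{finite,linorder}) set set" where
  "shi_regions r = components (- \<Union>(shi_arrangement r))"

definition cubic_entry :: "real ^ 'n::{finite,linorder} \<Rightarrow> 'n \<Rightarrow> 'n \<Rightarrow> nat \<Rightarrow> real" where
  "cubic_entry x i j k =
     (if i < j then x $ i - x $ j - real k
      else if i = j then 0
      else x $ i - x $ j - real k + 1)"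

definition col_nonpos :: "nat \<Rightarrow> real ^ 'n::{finite,linorder} \<Rightarrow> 'n \<Rightarrow> bool" where
  "col_nonpos r x j \<longleftrightarrow> (\<forall>i. \<forall>k\<in>{1..r}. cubic_entry x i j k \<le> 0)"

definition min_pos_at :: "nat \<Rightarrow> real ^ 'n::{finite,linorder} \<Rightarrow> 'n \<Rightarrow> 'n \<times> nat \<Rightarrow> bool" where
  "min_pos_at r x j = (\<lambda>(p, q).
     q \<in> {1..r} \<and> cubic_entry x p j q > 0 \<and>
     (\<forall>i. \<forall>k\<in>{1..r}. cubic_entry x i j k > 0 \<longrightarrow> cubic_entry x p j q \<le> cubic_entry x i j k))"

text \<open>
  The pair \<open>(p\<^sub>j, q\<^sub>j)\<close>; the value \<^const>\<open>None\<close> stands for the convention \<open>p\<^sub>j = 0\<close>.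
\<close>

definition pq :: "nat \<Rightarrow> real ^ 'n::{finite,linorder} \<Rightarrow> 'n \<Rightarrow> ('n \<times> nat) option" where
  "pq r x j = (if col_nonpos r x j then None else Some (THE u. min_pos_at r x j u))"

datatype 'n vertex = Ov nat | Vv 'n

definition O_set :: "nat \<Rightarrow> 'n vertex set" where
  "O_set r = Ov ` {1..r}"

definition V_set :: "'n vertex set" where
  "V_set = range Vv"

text \<open>
  The tuple \<open>f(v\<^sub>j)\<close> as a list; its entry \<open>f\<^sub>i(v\<^sub>j)\<close> has list index \<open>i - 1\<close>. No termination
  proof is supplied: that the recursion terminates on \<open>v\<^sub>j\<close> is the proposition
  \<open>shi_f_dom (r, x, j)\<close> generated by the function package, and the recursion equation is
  available only on this domain.
\<close>

function (domintros) shi_f :: "nat \<Rightarrow> real ^ 'n::{finite,linorder} \<Rightarrow> 'n \<Rightarrow> 'n vertex list" where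
  "shi_f r x j =
     (case pq r x j of
        None \<Rightarrow> map Ov [1..<Suc r]
      | Some (p, q) \<Rightarrow> take (q - 1) (shi_f r x p) @ drop q (shi_f r x p) @ [Vv p])"
  by pat_completeness auto

definition shi_F :: "nat \<Rightarrow> real ^ 'n::{finite,linorder} \<Rightarrow> 'n \<Rightarrow> 'n vertex set" where
  "shi_F r x j = set (shi_f r x j)"

text \<open>
  All graphs live on the fixed vertex set \<open>O \<union> V\<close>, so a graph is given by its set of edges,
  which are two-element sets of vertices.
\<close>

definition graph_on :: "'a set \<Rightarrow> 'a set set \<Rightarrow> bool" where
  "graph_on W E \<longleftrightarrow> (\<forall>e\<in>E. e \<subseteq> W \<and> card e = 2)"

definition mutually_adjacent :: "'a set set \<Rightarrow> 'a set \<Rightarrow> bool" where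
  "mutually_adjacent E K \<longleftrightarrow> (\<forall>u\<in>K. \<forall>w\<in>K. u \<noteq> w \<longrightarrow> {u, w} \<in> E)"

definition is_clique :: "nat \<Rightarrow> 'a set set \<Rightarrow> 'a set \<Rightarrow> bool" where
  "is_clique m E K \<longleftrightarrow> finite K \<and> card K = m \<and> mutually_adjacent E K"

definition shi_tree :: "nat \<Rightarrow> real ^ 'n::{finite,linorder} \<Rightarrow> 'n vertex set set" where
  "shi_tree r x =
     (\<Union>j. {{u, w} | u w. u \<noteq> w \<and> u \<in> insert (Vv j) (shi_F r x j)
                              \<and> w \<in> insert (Vv j) (shi_F r x j)})"

definition valid_rearrangement :: "nat \<Rightarrow> 'n vertex set set \<Rightarrow> 'n list \<Rightarrow> bool" where
  "valid_rearrangement r E vs \<longleftrightarrow>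
     distinct vs \<and> set vs = UNIV \<and>
     (\<forall>j<length vs.
        let N = {u \<in> O_set r \<union> Vv ` set (take j vs). {Vv (vs ! j), u} \<in> E}
        in card N = r \<and> mutually_adjacent E N)"

definition rooted_r_trees :: "nat \<Rightarrow> 'n::finite vertex set set set" where
  "rooted_r_trees r =
     {E. graph_on (O_set r \<union> V_set) E \<and> (\<exists>vs. valid_rearrangement r E vs)}"

definition Psi :: "nat \<Rightarrow> (real ^ 'n::{finite,linorder}) set \<Rightarrow> 'n vertex set set" where
  "Psi r \<Delta> = shi_tree r (SOME x. x \<in> \<Delta>)"

end

theory Submission
  imports Defs
begin

text \<open>
  Both regions and rooted \<open>r\<close>-trees are encoded by the forests \<open>j \<mapsto> (p\<^sub>j, q\<^sub>j)\<close> on \<open>[n]\<close> with edge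
  labels in \<open>[r]\<close>.

  Entries \<open>c\<^sub>i\<^sub>j\<^sub>k\<close> and \<open>c\<^sub>p\<^sub>j\<^sub>q\<close> of one column differ by \<open>x\<^sub>i - x\<^sub>p\<close> plus an integer belonging to a
  hyperplane of the arrangement. Hence the position of \<open>x\<close> relative to the hyperplanes between
  \<open>i\<close> and \<open>j\<close> is determined by \<open>(p\<^sub>j, q\<^sub>j)\<close> and its position relative to those between \<open>i\<close> and
  \<open>p\<^sub>j\<close>, and the region can be recovered from the forest by going up to the roots. Conversely
  every forest occurs: put each vertex infinitesimally below the level prescribed by its parent.

  In an \<open>r\<close>-tree the earlier neighbours of a vertex do not depend on the valid rearrangement;
  the list \<open>f(v\<^sub>j)\<close> enumerates them in order of appearance, so \<open>p = p\<^sub>j\<close> is the last of them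
  and \<open>q\<^sub>j\<close> is the position in \<open>f(v\<^sub>p)\<close> of the one vertex missing from \<open>F(v\<^sub>j)\<close>.
\<close>


section \<open>Regions and minimal positive entries\<close>

text \<open>Indexing by ordered pairs in both directions: the levels are -r+1..r for i < j and their
  negatives -r..r-1 for j < i. Later arguments can then swap a pair by negating m.\<close>

definition shi_level :: "nat \<Rightarrow> 'n::linorder \<Rightarrow> 'n \<Rightarrow> int \<Rightarrow> bool" where
  "shi_level r i j m \<longleftrightarrow>
     i \<noteq> j \<and> of_bool (i < j) - int r \<le> m \<and> m \<le> int r - of_bool (j < i)"

text \<open>On generic points equality never occurs, so agreement of these strict inequalities is
  agreement of the full sign vectors. The resulting classes of generic points are the
  regions.\<close>

definition same_side :: "nat \<Rightarrow> real ^ 'n::{finite,linorder} \<Rightarrow> real ^ 'n::{finite,linorder} \<Rightarrow> bool" where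
  "same_side r x y \<longleftrightarrow>
     (\<forall>i j m. shi_level r i j m \<longrightarrow> (of_int m < x $ i - x $ j \<longleftrightarrow> of_int m < y $ i - y $ j))"

abbreviation shi_generic :: "nat \<Rightarrow> (real ^ 'n::{finite,linorder}) set" where
  "shi_generic r \<equiv> - \<Union>(shi_arrangement r)"

lemma shi_level_swap: "shi_level r i j m \<longleftrightarrow> shi_level r j i (- m)"
  by (auto simp: shi_level_def)

lemma shi_generic_iff:
  fixes x :: "real ^ 'n::{finite,linorder}"
  shows "x \<in> shi_generic r \<longleftrightarrow> (\<forall>i j m. shi_level r i j m \<longrightarrow> x $ i - x $ j \<noteq> of_int m)"
    (is "?L \<longleftrightarrow> ?R")
proof
  assume L: ?L
  have *: "x $ i - x $ j \<noteq> of_int m" if "i < j" "shi_level r i j m" for i j m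
  proof
    assume "x $ i - x $ j = of_int m"
    moreover have "m \<in> {- int r + 1..int r}"
      using that by (auto simp: shi_level_def of_bool_def split: if_splits)
    ultimately have "x \<in> \<Union>(shi_arrangement r)"
      using \<open>i < j\<close> unfolding shi_arrangement_def by blast
    with L show False by blast
  qed
  show ?R
  proof (intro allI impI)
    fix i j :: 'n and m assume lev: "shi_level r i j m"
    show "x $ i - x $ j \<noteq> of_int m"
    proof (cases "i < j")
      case False
      with lev have "j < i" by (auto simp: shi_level_def)
      with lev *[of j i "- m"] show ?thesis by (auto simp: shi_level_swap[of r i])
    qed (use lev * in blast)
  qed
next
  assume R: ?R
  show ?L
  proof
    assume "x \<in> \<Union>(shi_arrangement r)"
    then obtain i j a where "i < j" "a \<in> {- int r + 1..int r}" "x $ i - x $ j = of_int a"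
      unfolding shi_arrangement_def by blast
    moreover from this have "shi_level r i j a" by (auto simp: shi_level_def)
    ultimately show False using R by blast
  qed
qed

lemma shi_genericD: "x \<in> shi_generic r \<Longrightarrow> shi_level r i j m \<Longrightarrow> x $ i - x $ j \<noteq> of_int m"
  unfolding shi_generic_iff by blast

lemma shi_generic_neq:
  assumes "x \<in> shi_generic r" "r \<ge> 1" "i \<noteq> j"
  shows "x $ i \<noteq> x $ j"
proof -
  have "shi_level r i j 0" using assms by (auto simp: shi_level_def)
  from shi_genericD[OF assms(1) this] show ?thesis by simp
qed

text \<open>Both open sides of a hyperplane are convex, so a segment with both ends on one side
  never meets it.\<close>

lemma same_side_segment:
  assumes "x \<in> shi_generic r" "y \<in> shi_generic r" "same_side r x y"
  shows "closed_segment x y \<subseteq> shi_generic r"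
proof
  fix z assume "z \<in> closed_segment x y"
  then obtain u where u: "0 \<le> u" "u \<le> 1" "z = (1 - u) *\<^sub>R x + u *\<^sub>R y"
    by (auto simp: in_segment)
  have "z $ i - z $ j \<noteq> of_int m" if lev: "shi_level r i j m" for i j m
  proof -
    define a b where "a = x $ i - x $ j" and "b = y $ i - y $ j"
    have z: "z $ i - z $ j = (1 - u) * a + u * b"
      by (simp add: u a_def b_def algebra_simps)
    have ne: "a \<noteq> of_int m" "b \<noteq> of_int m" and ss: "of_int m < a \<longleftrightarrow> of_int m < b"
      using shi_genericD[OF assms(1) lev] shi_genericD[OF assms(2) lev] assms(3) lev
      unfolding same_side_def a_def b_def by blast+
    show ?thesis
    proof (cases "of_int m < a")
      case True
      with ss have "- a < - of_int m" "- b < - of_int m" by auto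
      then have "(1 - u) * (- a) + u * (- b) < - of_int m"
        by (rule convex_bound_lt) (use u in auto)
      with z show ?thesis by (simp add: algebra_simps)
    next
      case False
      with ss ne have "a < of_int m" "b < of_int m" by auto
      then have "(1 - u) * a + u * b < of_int m"
        by (rule convex_bound_lt) (use u in auto)
      with z show ?thesis by simp
    qed
  qed
  then show "z \<in> shi_generic r" unfolding shi_generic_iff by blast
qed

lemma shi_region_subset: "\<Delta> \<in> shi_regions r \<Longrightarrow> \<Delta> \<subseteq> shi_generic r"
  unfolding shi_regions_def by (rule in_components_subset)

text \<open>The function \<open>z $ i - z $ j\<close> maps the connected set \<Delta> onto an
  interval that omits every level m of the arrangement.\<close>

lemma shi_region_same_side:
  assumes "\<Delta> \<in> shi_regions r" "x \<in> \<Delta>" "y \<in> \<Delta>"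
  shows "same_side r x y"
proof -
  have conn: "connected \<Delta>" and sub: "\<Delta> \<subseteq> shi_generic r"
    using assms(1) by (auto simp: shi_regions_def in_components_connected in_components_subset)
  have *: "of_int m < v $ i - v $ j"
    if "shi_level r i j m" "of_int m < u $ i - u $ j" "u \<in> \<Delta>" "v \<in> \<Delta>" for i j m u v
  proof (rule ccontr)
    assume "\<not> of_int m < v $ i - v $ j"
    then have "v $ i - v $ j \<le> of_int m" "of_int m \<le> u $ i - u $ j" using that(2) by auto
    moreover have "connected ((\<lambda>z. z $ i - z $ j) ` \<Delta>)"
      by (intro connected_continuous_image conn continuous_intros)
    ultimately have "of_int m \<in> (\<lambda>z. z $ i - z $ j) ` \<Delta>"
      using that(3,4) by (meson connectedD_interval imageI)
    then obtain z where "z \<in> \<Delta>" "z $ i - z $ j = of_int m" by auto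
    then show False using sub that(1) shi_genericD by blast
  qed
  show ?thesis
    unfolding same_side_def using *[of _ _ _ x y] *[of _ _ _ y x] assms by blast
qed

lemma same_side_shi_region:
  assumes "\<Delta> \<in> shi_regions r" "x \<in> \<Delta>" "y \<in> shi_generic r" "same_side r x y"
  shows "y \<in> \<Delta>"
proof -
  have "closed_segment x y \<subseteq> shi_generic r"
    using assms shi_region_subset same_side_segment by blast
  then have "closed_segment x y \<subseteq> \<Delta>"
    using assms(1,2) components_maximal[of \<Delta> "shi_generic r" "closed_segment x y"]
    unfolding shi_regions_def by (metis connected_segment disjoint_iff ends_in_segment(1))
  then show ?thesis by auto
qed

lemma ex_shi_region:
  assumes "x \<in> shi_generic r"
  obtains \<Delta> where "\<Delta> \<in> shi_regions r" "x \<in> \<Delta>"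
  using assms unfolding shi_regions_def by (metis Union_components UnionE)

lemma shi_region_nonempty: "\<Delta> \<in> shi_regions r \<Longrightarrow> \<Delta> \<noteq> {}"
  unfolding shi_regions_def by (rule in_components_nonempty)

lemma shi_region_eqI:
  assumes "\<Delta> \<in> shi_regions r" "\<Delta>' \<in> shi_regions r" "x \<in> \<Delta>" "y \<in> \<Delta>'" "same_side r x y"
  shows "\<Delta> = \<Delta>'"
proof -
  have "y \<in> \<Delta>"
    using assms same_side_shi_region shi_region_subset by blast
  with assms show ?thesis unfolding shi_regions_def by (metis components_eq disjoint_iff)
qed

section \<open>Comparing the entries of one column\<close>

lemma cubic_entry_alt:
  "i \<noteq> j \<Longrightarrow> cubic_entry x i j k = x $ i - x $ j - real k + of_bool (j < i)"
  by (auto simp: cubic_entry_def)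

lemma cubic_entry_less_iff:
  assumes "i \<noteq> j" "p \<noteq> j"
  shows "cubic_entry x i j k < cubic_entry x p j q \<longleftrightarrow>
    of_int (int q - int k + of_bool (j < i) - of_bool (j < p)) < x $ p - x $ i"
  using assms by (auto simp: cubic_entry_alt)

lemma cubic_entry_pos_iff:
  assumes "i \<noteq> j"
  shows "cubic_entry x i j k > 0 \<longleftrightarrow> of_int (int k - of_bool (j < i)) < x $ i - x $ j"
  using assms by (auto simp: cubic_entry_alt)

lemma shi_level_pos:
  "i \<noteq> j \<Longrightarrow> k \<in> {1..r} \<Longrightarrow> shi_level r i j (int k - of_bool (j < i))"
  by (auto simp: shi_level_def)

text \<open>Here the asymmetry of the arrangement matters: q - k has absolute value below r, and the
  difference of the indicators is 0 or 1 if p < i and 0 or -1 if i < p, just the direction in which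
  the range for (p, i) has one more level.\<close>

lemma shi_level_compare:
  assumes "i \<noteq> p" "k \<in> {1..r}" "q \<in> {1..r}"
  shows "shi_level r p i (int q - int k + of_bool (j < i) - of_bool (j < p))"
  using assms by (auto simp: shi_level_def)

text \<open>Equal entries in different rows would put x on a hyperplane by
  \<open>shi_level_compare\<close>; within one row k separates the entries.\<close>

lemma cubic_entry_inj:
  assumes "x \<in> shi_generic r" "k \<in> {1..r}" "q \<in> {1..r}" "i \<noteq> j" "p \<noteq> j"
    and "cubic_entry x i j k = cubic_entry x p j q"
  shows "i = p \<and> k = q"
proof -
  have "i = p"
  proof (rule ccontr)
    assume "i \<noteq> p"
    from shi_level_compare[OF this assms(2,3)] assms(1)
    have "x $ p - x $ i \<noteq> of_int (int q - int k + of_bool (j < i) - of_bool (j < p))"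
      unfolding shi_generic_iff by blast
    with assms(4-6) show False by (auto simp: cubic_entry_alt)
  qed
  with assms show ?thesis by (auto simp: cubic_entry_alt)
qed

lemma min_pos_atD:
  assumes "min_pos_at r x j (p, q)"
  shows "q \<in> {1..r}" "cubic_entry x p j q > 0" "p \<noteq> j"
    and "\<And>i k. k \<in> {1..r} \<Longrightarrow> cubic_entry x i j k > 0 \<Longrightarrow> cubic_entry x p j q \<le> cubic_entry x i j k"
  using assms by (auto simp: min_pos_at_def cubic_entry_def[of x j j])

text \<open>A minimum exists because there are finitely many positive entries, and
  \<open>cubic_entry_inj\<close> excludes ties.\<close>

lemma ex1_min_pos_at:
  assumes "x \<in> shi_generic r" "\<not> col_nonpos r x j"
  shows "\<exists>!u. min_pos_at r x j u"
proof -
  define S where "S = {(i, k). k \<in> {1..r} \<and> cubic_entry x i j k > 0}"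
  have "S \<subseteq> UNIV \<times> {1..r}" by (auto simp: S_def)
  then have fin: "finite S" by (rule finite_subset) auto
  obtain i k where "k \<in> {1..r}" "\<not> cubic_entry x i j k \<le> 0"
    using assms(2) unfolding col_nonpos_def by blast
  then have "(i, k) \<in> S" by (simp add: S_def)
  then have "S \<noteq> {}" by blast
  define u where "u = arg_min_on (\<lambda>(i, k). cubic_entry x i j k) S"
  have uS: "u \<in> S" unfolding u_def by (rule arg_min_if_finite(1)[OF fin \<open>S \<noteq> {}\<close>])
  have least: "(\<lambda>(i, k). cubic_entry x i j k) u \<le> (\<lambda>(i, k). cubic_entry x i j k) w"
    if "w \<in> S" for w
    unfolding u_def by (rule arg_min_least[OF fin \<open>S \<noteq> {}\<close> that])
  have "min_pos_at r x j u"
    unfolding min_pos_at_def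
  proof (cases u, simp only: prod.case, intro conjI allI ballI impI)
    fix p q assume u: "u = (p, q)"
    show "q \<in> {1..r}" "cubic_entry x p j q > 0" using uS u by (simp_all add: S_def)
    fix i k assume "k \<in> {1..r}" "cubic_entry x i j k > 0"
    then show "cubic_entry x p j q \<le> cubic_entry x i j k"
      using least[of "(i, k)"] u by (simp add: S_def)
  qed
  moreover have "w = u" if "min_pos_at r x j w" for w
  proof -
    obtain p q p' q' where eq: "u = (p, q)" "w = (p', q')" by (cases u, cases w)
    have m: "min_pos_at r x j (p, q)" "min_pos_at r x j (p', q')"
      using \<open>min_pos_at r x j u\<close> that by (simp_all add: eq)
    note D = min_pos_atD[OF m(1)] and D' = min_pos_atD[OF m(2)]
    have "cubic_entry x p j q = cubic_entry x p' j q'"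
      using D(4)[OF D'(1,2)] D'(4)[OF D(1,2)] by simp
    then show ?thesis
      using cubic_entry_inj[OF assms(1) D(1) D'(1) D(3) D'(3)] by (simp add: eq)
  qed
  ultimately show ?thesis by blast
qed

lemma min_pos_at_not_col_nonpos: "min_pos_at r x j u \<Longrightarrow> \<not> col_nonpos r x j"
  unfolding col_nonpos_def by (metis linorder_not_less min_pos_atD(1,2) surj_pair)

lemma pq_eq_None_iff: "pq r x j = None \<longleftrightarrow> col_nonpos r x j"
  by (simp add: pq_def)

lemma pq_eq_Some_iff:
  assumes "x \<in> shi_generic r"
  shows "pq r x j = Some u \<longleftrightarrow> min_pos_at r x j u"
proof (cases "col_nonpos r x j")
  case True
  then show ?thesis using min_pos_at_not_col_nonpos[of r x j u] by (auto simp: pq_def)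
next
  case False
  from ex1_min_pos_at[OF assms this] show ?thesis
    using False by (auto simp: pq_def intro: theI' the1_equality)
qed

lemma same_side_cubic_entry_pos:
  assumes "same_side r x y" "k \<in> {1..r}"
  shows "cubic_entry x i j k > 0 \<longleftrightarrow> cubic_entry y i j k > 0"
proof (cases "i = j")
  case False
  with shi_level_pos[OF False assms(2)] assms(1) show ?thesis
    unfolding cubic_entry_pos_iff[OF False] same_side_def by blast
qed (simp add: cubic_entry_def)

lemma same_side_cubic_entry_less:
  assumes "same_side r x y" "k \<in> {1..r}" "q \<in> {1..r}" "i \<noteq> j" "p \<noteq> j"
  shows "cubic_entry x i j k < cubic_entry x p j q \<longleftrightarrow> cubic_entry y i j k < cubic_entry y p j q"
proof (cases "i = p")
  case True
  then show ?thesis using assms(4,5) by (auto simp: cubic_entry_def)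
next
  case False
  with shi_level_compare[OF False assms(2,3)] assms(1) show ?thesis
    unfolding cubic_entry_less_iff[OF assms(4,5)] same_side_def by blast
qed

text \<open>Minimality involves only signs of entries and comparisons within the column, and each of
  these is a side of a hyperplane.\<close>

lemma same_side_min_pos_at:
  assumes "same_side r x y"
  shows "min_pos_at r x j (p, q) \<longleftrightarrow> min_pos_at r y j (p, q)"
proof (cases "q \<in> {1..r} \<and> cubic_entry x p j q > 0")
  case True
  then have "p \<noteq> j" by (auto simp: cubic_entry_def)
  have *: "cubic_entry x i j k > 0 \<and> cubic_entry x i j k < cubic_entry x p j q \<longleftrightarrow>
    cubic_entry y i j k > 0 \<and> cubic_entry y i j k < cubic_entry y p j q"
    if "k \<in> {1..r}" for i k
  proof (cases "i = j")
    case False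
    then show ?thesis
      using same_side_cubic_entry_pos[OF assms that]
        same_side_cubic_entry_less[OF assms that _ False \<open>p \<noteq> j\<close>] True by blast
  qed (simp add: cubic_entry_def)
  have "cubic_entry y p j q > 0"
    using True same_side_cubic_entry_pos[OF assms] by blast
  with True * show ?thesis unfolding min_pos_at_def prod.case not_less[symmetric] by blast
next
  case False
  then show ?thesis using same_side_cubic_entry_pos[OF assms] by (auto simp: min_pos_at_def)
qed

lemma same_side_pq:
  assumes "x \<in> shi_generic r" "y \<in> shi_generic r" "same_side r x y"
  shows "pq r x = pq r y"
proof
  fix j
  have "pq r x j = Some u \<longleftrightarrow> pq r y j = Some u" for u
    using same_side_min_pos_at[OF assms(3)] assms(1,2) by (cases u) (simp add: pq_eq_Some_iff)
  then show "pq r x j = pq r y j" by (metis option.exhaust)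
qed

section \<open>Recovering a region from its forest\<close>

definition rank_above :: "real ^ 'n::finite \<Rightarrow> 'n \<Rightarrow> nat" where
  "rank_above x j = card {i. x $ j < x $ i}"

lemma rank_above_less_iff: "rank_above x i < rank_above x j \<longleftrightarrow> x $ j < x $ i"
proof -
  have "rank_above x i < rank_above x j" if "x $ j < x $ i" for i j
    unfolding rank_above_def by (rule psubset_card_mono) (use that in auto)
  moreover have "rank_above x j \<le> rank_above x i" if "x $ i \<le> x $ j" for i j
    unfolding rank_above_def by (rule card_mono) (use that in auto)
  ultimately show ?thesis by (metis not_less)
qed

text \<open>A positive entry with q at least 1 forces x_p > x_j, so fewer coordinates lie above p
  than above j. This measure makes \<open>pq r x\<close> acyclic and the recursion for f
  terminate.\<close>

lemma pq_Some_D: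
  assumes "x \<in> shi_generic r" "pq r x j = Some (p, q)"
  shows "q \<in> {1..r}" "p \<noteq> j" "rank_above x p < rank_above x j"
proof -
  have m: "min_pos_at r x j (p, q)" using assms by (simp add: pq_eq_Some_iff)
  show "q \<in> {1..r}" "p \<noteq> j" using min_pos_atD[OF m] by blast+
  have "of_int (int q - of_bool (j < p)) < x $ p - x $ j"
    using min_pos_atD(2)[OF m] cubic_entry_pos_iff[OF \<open>p \<noteq> j\<close>] by blast
  with \<open>q \<in> {1..r}\<close> show "rank_above x p < rank_above x j"
    by (cases "j < p") (auto simp: rank_above_less_iff)
qed

text \<open>An entry is positive exactly if it is not below the minimal positive one, and x_j
  cancels in this comparison. A question about i and j thus becomes one about i and the parent
  p.\<close>

lemma cubic_entry_pos_iff_pq: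
  assumes "x \<in> shi_generic r" "pq r x j = Some (p, q)" "i \<noteq> j" "k \<in> {1..r}"
  shows "cubic_entry x i j k > 0 \<longleftrightarrow>
    (if i = p then k \<le> q
     else \<not> of_int (int q - int k + of_bool (j < i) - of_bool (j < p)) < x $ p - x $ i)"
proof -
  have m: "min_pos_at r x j (p, q)" using assms by (simp add: pq_eq_Some_iff)
  then have "p \<noteq> j" by (rule min_pos_atD)
  have "cubic_entry x i j k > 0 \<longleftrightarrow> \<not> cubic_entry x i j k < cubic_entry x p j q"
    using min_pos_atD(2,4)[OF m] assms(4) by (meson less_le_trans not_less)
  then show ?thesis
    unfolding cubic_entry_less_iff[OF assms(3) \<open>p \<noteq> j\<close>] using \<open>p \<noteq> j\<close> by auto
qed

text \<open>Induction on the rank sum of a pair: \<open>cubic_entry_pos_iff_pq\<close> replaces one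
  member by its parent, which has smaller rank. The ranks of x serve for y as well, since both
  points have the same parents.\<close>

lemma pq_determines_same_side:
  assumes x: "x \<in> shi_generic r" and y: "y \<in> shi_generic r" and eq: "pq r x = pq r y"
  shows "same_side r x y"
proof -
  define S where "S i j \<longleftrightarrow> (\<forall>m. shi_level r i j m \<longrightarrow>
    (of_int m < x $ i - x $ j \<longleftrightarrow> of_int m < y $ i - y $ j))" for i j
  have swap: "S i j" if "S j i" for i j
    unfolding S_def
  proof (intro allI impI)
    fix m assume lev: "shi_level r i j m"
    then have lev': "shi_level r j i (- m)" by (simp add: shi_level_swap[of r i])
    have "x $ i - x $ j \<noteq> of_int m" "y $ i - y $ j \<noteq> of_int m"
      using shi_genericD[OF x lev] shi_genericD[OF y lev] .
    moreover have "of_int (- m) < x $ j - x $ i \<longleftrightarrow> of_int (- m) < y $ j - y $ i"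
      using that lev' unfolding S_def by blast
    ultimately show "of_int m < x $ i - x $ j \<longleftrightarrow> of_int m < y $ i - y $ j" by auto
  qed
  have "S i j" for i j
  proof (induction "rank_above x i + rank_above x j" arbitrary: i j rule: less_induct)
    case less
    have pos: "cubic_entry x a b k > 0 \<longleftrightarrow> cubic_entry y a b k > 0"
      if ab: "a = i \<and> b = j \<or> a = j \<and> b = i" and "a \<noteq> b" "k \<in> {1..r}" for a b k
    proof (cases "pq r x b")
      case None
      then have "col_nonpos r x b" "col_nonpos r y b"
        using eq pq_eq_None_iff by metis+
      with that show ?thesis by (auto simp: col_nonpos_def not_less[symmetric])
    next
      case (Some u)
      obtain p q where u: "u = (p, q)" by (cases u)
      have px: "pq r x b = Some (p, q)" and py: "pq r y b = Some (p, q)" using Some u eq by auto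
      note D = pq_Some_D[OF x px]
      have "S p a"
        using less[of p a] D(3) ab by auto
      then have "of_int (int q - int k + of_bool (b < a) - of_bool (b < p)) < x $ p - x $ a \<longleftrightarrow>
        of_int (int q - int k + of_bool (b < a) - of_bool (b < p)) < y $ p - y $ a" if "a \<noteq> p"
        using shi_level_compare[OF that \<open>k \<in> {1..r}\<close> D(1)] unfolding S_def by blast
      then show ?thesis
        unfolding cubic_entry_pos_iff_pq[OF x px \<open>a \<noteq> b\<close> \<open>k \<in> {1..r}\<close>]
          cubic_entry_pos_iff_pq[OF y py \<open>a \<noteq> b\<close> \<open>k \<in> {1..r}\<close>] by auto
    qed
    text \<open>Each hyperplane between \<open>i\<close> and \<open>j\<close> is tested in exactly one of their two columns.\<close>
    have half: "of_int m < x $ a - x $ b \<longleftrightarrow> of_int m < y $ a - y $ b"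
      if ab: "a = i \<and> b = j \<or> a = j \<and> b = i" and lev: "shi_level r a b m"
        and m: "of_bool (a < b) \<le> m" for a b m
    proof -
      define k where "k = nat (m + of_bool (b < a))"
      have k: "k \<in> {1..r}" "int k - of_bool (b < a) = m" "a \<noteq> b"
        using lev m by (cases "a < b"; auto simp: k_def shi_level_def)+
      show ?thesis
        using pos[OF ab k(3,1)] unfolding cubic_entry_pos_iff[OF k(3)] k(2) .
    qed
    show "S i j" unfolding S_def
    proof (intro allI impI)
      fix m assume lev: "shi_level r i j m"
      show "of_int m < x $ i - x $ j \<longleftrightarrow> of_int m < y $ i - y $ j"
      proof (cases "of_bool (i < j) \<le> m")
        case True
        then show ?thesis using half lev by blast
      next
        case False
        \<comment> \<open>The levels not tested in column j are tested, with opposite sign, in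
          column i.\<close>
        then have "of_bool (j < i) \<le> - m" using lev by (cases "i < j") (auto simp: shi_level_def)
        with half[of j i "- m"] lev
        have "of_int (- m) < x $ j - x $ i \<longleftrightarrow> of_int (- m) < y $ j - y $ i"
          by (simp add: shi_level_swap[of r i])
        moreover have "x $ i - x $ j \<noteq> of_int m" "y $ i - y $ j \<noteq> of_int m"
          using shi_genericD[OF x lev] shi_genericD[OF y lev] .
        ultimately show ?thesis by auto
      qed
    qed
  qed
  then show ?thesis by (simp add: same_side_def S_def)
qed

section \<open>Every labelled forest comes from a region\<close>

lemma wf_pq_rel:
  fixes D :: "'n \<Rightarrow> nat"
  assumes "\<And>j p q. P j = Some (p, q) \<Longrightarrow> D p < D j"
  shows "wf {(p, j). \<exists>q. P j = Some (p, q)}"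
  by (rule wf_subset[OF wf_measure[of D]]) (use assms in auto)

text \<open>Well-founded recursion from the roots downwards; it supplies the integer levels and the
  root paths in \<open>realization\<close>.\<close>

lemma forest_recursion:
  fixes P :: "'n \<Rightarrow> ('n \<times> 'q) option" and D :: "'n \<Rightarrow> nat"
  assumes D: "\<And>j p q. P j = Some (p, q) \<Longrightarrow> D p < D j"
  obtains h where "\<And>j. h j = (case P j of None \<Rightarrow> a j | Some (p, q) \<Rightarrow> b j p q (h p))"
proof -
  define R where "R = {(p, j). \<exists>q. P j = Some (p, q)}"
  have "wf R" unfolding R_def using wf_pq_rel[of P D, OF D] .
  define H where "H = (\<lambda>h j. case P j of None \<Rightarrow> a j | Some (p, q) \<Rightarrow> b j p q (h p))"
  have "wfrec R H j = H (wfrec R H) j" for j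
    by (subst wfrec[OF \<open>wf R\<close>]) (auto simp: H_def R_def cut_apply split: option.split)
  then show thesis unfolding H_def by (rule that)
qed

text \<open>By asymmetry \<open>zs\<close> cannot deviate from \<open>xs\<close> at an entry of
  \<open>xs\<close>, so it properly extends \<open>xs\<close>, and its first additional entry must
  come before \<open>y\<close>.\<close>

lemma lexord_between_snoc:
  assumes "asym E" "(xs, zs) \<in> lexord E" "(zs, xs @ [y]) \<in> lexord E"
  shows "\<exists>s \<in> set zs. (s, y) \<in> E"
  using assms(2,3)
proof (induction xs arbitrary: zs)
  case Nil
  then show ?case by (cases zs) auto
next
  case (Cons a xs)
  then obtain b zs' where zs: "zs = b # zs'" by (cases zs) auto
  with Cons.prems assms(1) have "b = a" "(xs, zs') \<in> lexord E" "(zs', xs @ [y]) \<in> lexord E"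
    by (auto dest: asymD)
  then show ?case using Cons.IH[of zs'] zs by auto
qed

text \<open>A measure decreasing towards parents is what makes \<open>P\<close> a forest. As a
  parameter, \<open>D\<close> can be a rank of coordinates as well as a position in a
  rearrangement.\<close>

locale labelled_forest =
  fixes r :: nat and P :: "'n::{finite,linorder} \<Rightarrow> ('n \<times> nat) option" and D :: "'n \<Rightarrow> nat"
  assumes label: "P j = Some (p, q) \<Longrightarrow> q \<in> {1..r}"
    and above: "P j = Some (p, q) \<Longrightarrow> D p < D j"
begin

text \<open>
  Up to infinitesimal shifts, a vertex \<open>j\<close> sits just below \<open>x\<^sub>p - q + [p > j]\<close>. With the roots
  at \<open>0\<close>, its integer level is thus \<open>- K j\<close>. Among siblings, those with larger \<open>K\<close> and, for equal
  \<open>K\<close>, with smaller index have to be closer to the parent; the infinitesimal shifts follow the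
  preorder traversal, i.e. the lexicographic order of the root paths.
\<close>

lemma realization:
  obtains x where "x \<in> shi_generic r" "pq r x = P"
proof -
  obtain K :: "'n \<Rightarrow> int" where K: "K j = (case P j of None \<Rightarrow> 0
      | Some (p, q) \<Rightarrow> K p + int q - of_bool (j < p))" for j
    by (rule forest_recursion[of P D "\<lambda>_. 0 :: int" "\<lambda>j p q k. k + int q - of_bool (j < p)"])
      (use above in blast)+
  obtain path where "path j = (case P j of None \<Rightarrow> [j] | Some (p, q) \<Rightarrow> path p @ [j])" for j
    by (rule forest_recursion[of P D "\<lambda>j. [j]" "\<lambda>j p q ps. ps @ [j]"]) (use above in blast)+
  then have path: "path j = (case P j of None \<Rightarrow> [] | Some (p, q) \<Rightarrow> path p) @ [j]" for j
    by (cases "P j") auto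
  have K_nonneg: "0 \<le> K j" for j
  proof (induction "D j" arbitrary: j rule: less_induct)
    case less
    show ?case
    proof (cases "P j")
      case (Some u)
      then obtain p q where "P j = Some (p, q)" by (cases u) auto
      then show ?thesis using K[of j] less[of p] above[of j p q] label[of j p q] by auto
    qed (use K[of j] in simp)
  qed
  define le where "le j i \<longleftrightarrow> K j < K i \<or> K j = K i \<and> i \<le> j" for i j
  have le_trans: "le i k" if "le i j" "le j k" for i j k
    using that by (auto simp: le_def)
  \<comment> \<open>If \<open>K j = K p\<close>, then q = 1 and j < p, which agrees with the way
    \<open>le\<close> breaks ties.\<close>
  have le_parent: "le p j" if "P j = Some (p, q)" for p q j
    using label[OF that] K[of j] that by (auto simp: le_def)
  have le_path: "le i j" if "i \<in> set (path j)" for i j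
    using that
  proof (induction "D j" arbitrary: j rule: less_induct)
    case less
    show ?case
    proof (cases "i = j")
      case False
      with less.prems obtain p q where "P j = Some (p, q)" "i \<in> set (path p)"
        unfolding path[of j] by (cases "P j") auto
      then show ?thesis using less.hyps[of p] above le_parent le_trans by blast
    qed (simp add: le_def)
  qed
  have last_path: "last (path j) = j" for j by (subst path) simp
  define E where "E = {(a, b). \<not> le a b}"
  have E_total: "\<forall>a b. (a, b) \<in> E \<or> a = b \<or> (b, a) \<in> E"
    by (auto simp: E_def le_def)
  have E_trans: "trans E" by (auto simp: E_def le_def trans_def)
  have E_asym: "asym E" by (auto simp: E_def le_def intro!: asymI)
  then have E_irrefl: "irrefl E" by (auto simp: irrefl_def dest: asymD)
  define L where "L = {(a, b). (path a, path b) \<in> lexord E}"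
  have L_trans: "(a, c) \<in> L" if "(a, b) \<in> L" "(b, c) \<in> L" for a b c
    using that lexord_trans[OF _ _ E_trans] by (auto simp: L_def)
  have L_irrefl: "(a, a) \<notin> L" for a
    using lexord_irreflexive[of E] E_irrefl by (auto simp: L_def irrefl_def)
  have L_total: "(a, b) \<in> L \<or> (b, a) \<in> L" if "a \<noteq> b" for a b
    using lexord_linear[OF E_total, of "path a" "path b"] that last_path[of a] last_path[of b]
    by (auto simp: L_def)
  \<comment> \<open>The position in preorder, scaled into [0,1) so that the shifts never outweigh a
    unit of integer level.\<close>
  define \<theta> :: "'n \<Rightarrow> real" where "\<theta> j = card {i. (i, j) \<in> L} / card (UNIV :: 'n set)" for j
  have mono: "\<theta> a < \<theta> b" if "(a, b) \<in> L" for a b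
  proof -
    have "{i. (i, a) \<in> L} \<subset> {i. (i, b) \<in> L}"
      using that L_trans L_irrefl by blast
    then show ?thesis by (simp add: \<theta>_def divide_strict_right_mono psubset_card_mono)
  qed
  have \<theta>_iff: "\<theta> a < \<theta> b \<longleftrightarrow> (a, b) \<in> L" for a b
    using mono[of a b] mono[of b a] L_total[of a b] by (metis less_asym less_irrefl)
  have \<theta>_inj: "\<theta> a \<noteq> \<theta> b" if "a \<noteq> b" for a b
    using mono[of a b] mono[of b a] L_total[OF that] by force
  have \<theta>_bounds: "0 \<le> \<theta> a" "\<theta> a < 1" for a
  proof -
    have "{i. (i, a) \<in> L} \<subset> UNIV" using L_irrefl[of a] by auto
    then have "card {i. (i, a) \<in> L} < card (UNIV :: 'n set)" by (intro psubset_card_mono) auto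
    then show "0 \<le> \<theta> a" "\<theta> a < 1" by (auto simp: \<theta>_def)
  qed
  \<comment> \<open>In preorder i lies before j but after the parent of j. Hence the path to i
    passes through a sibling s of j (another root, if j is a root) that precedes j. Since
    \<open>le\<close> holds along paths, \<open>le i j\<close> would give
    \<open>le s j\<close>.\<close>
  have key: "K j + of_bool (j < i) \<le> K i"
    if "\<theta> i < \<theta> j" and i: "\<And>p q. P j = Some (p, q) \<Longrightarrow> \<theta> p < \<theta> i" for i j
  proof -
    define pre where "pre = (case P j of None \<Rightarrow> [] | Some (p, q) \<Rightarrow> path p)"
    have pj: "path j = pre @ [j]" unfolding pre_def by (rule path)
    have lt: "(path i, pre @ [j]) \<in> lexord E" using that(1) pj unfolding \<theta>_iff L_def by simp
    have "pre = [] \<or> (pre, path i) \<in> lexord E"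
      using i unfolding \<theta>_iff L_def by (auto simp: pre_def split: option.split)
    moreover have "path i \<noteq> []" by (subst path) simp
    ultimately have gt: "(pre, path i) \<in> lexord E" by (cases "path i") auto
    have "\<exists>s \<in> set (path i). (s, j) \<in> E"
      using lexord_between_snoc[OF E_asym gt lt] .
    then obtain s where s: "s \<in> set (path i)" "\<not> le s j" by (auto simp: E_def)
    then have "le s i" by (blast intro: le_path)
    with s(2) show ?thesis by (auto simp: le_def split: if_splits)
  qed
  define x where "x = (\<chi> j. - real_of_int (K j) - \<theta> j)"
  have diff: "x $ i - x $ j = of_int (K j - K i) + (\<theta> j - \<theta> i)" for i j
    by (simp add: x_def)
  \<comment> \<open>Two distinct shifts differ by a nonzero number in (-1,1), so no coordinate
    difference is an integer.\<close>
  have gen: "x \<in> shi_generic r"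
    unfolding shi_generic_iff
  proof (intro allI impI notI)
    fix i j m assume "shi_level r i j m" "x $ i - x $ j = of_int m"
    then have "i \<noteq> j" "\<theta> j - \<theta> i = of_int (m - (K j - K i))"
      by (auto simp: shi_level_def diff)
    moreover from this \<theta>_bounds[of i] \<theta>_bounds[of j]
    have "-1 < m - (K j - K i)" "m - (K j - K i) < 1" by linarith+
    ultimately show False using \<theta>_inj[of i j] by simp
  qed
  have entry: "cubic_entry x i j k =
      of_int (K j - K i - int k + of_bool (j < i)) + (\<theta> j - \<theta> i)" if "i \<noteq> j" for i j k
    using that diff[of i j] by (auto simp: cubic_entry_def)
  have "pq r x j = P j" for j
  proof (cases "P j")
    case None
    have "cubic_entry x i j k \<le> 0" if "k \<in> {1..r}" for i k
    proof (cases "i = j")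
      case False
      have "K j = 0" using K[of j] None by simp
      then have e: "cubic_entry x i j k = of_int (of_bool (j < i) - K i - int k) + (\<theta> j - \<theta> i)"
        by (simp add: entry[OF False])
      show ?thesis
      proof (cases "\<theta> i < \<theta> j")
        case True
        \<comment> \<open>For a root, a positive shift difference is paid for by \<open>key\<close>,
          which lowers the integer part to at most -1.\<close>
        from key[OF this] None \<open>K j = 0\<close> that have "of_bool (j < i) - K i - int k \<le> - 1" by auto
        then have "real_of_int (of_bool (j < i) - K i - int k) \<le> - 1" by linarith
        then show ?thesis unfolding e using \<theta>_bounds[of i] \<theta>_bounds[of j] by linarith
      next
        case False
        have "of_bool (j < i) - K i - int k \<le> 0" using K_nonneg[of i] that by auto
        then have "real_of_int (of_bool (j < i) - K i - int k) \<le> 0" by linarith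
        then show ?thesis unfolding e using False by linarith
      qed
    qed (simp add: cubic_entry_def)
    then show ?thesis using None by (simp add: pq_def col_nonpos_def)
  next
    case (Some u)
    obtain p q where u: "u = (p, q)" by (cases u)
    have P: "P j = Some (p, q)" using Some u by simp
    then have "p \<noteq> j" using above by blast
    \<comment> \<open>The recursion for \<open>K\<close> is chosen so that the integer part vanishes
      at (p, q), leaving only the shifts.\<close>
    have pos: "cubic_entry x p j q = \<theta> j - \<theta> p"
      using entry[OF \<open>p \<noteq> j\<close>] K[of j] P by simp
    have "path j = path p @ [j]" using path[of j] P by simp
    then have "(p, j) \<in> L" by (auto simp: L_def lexord_append_rightI)
    then have gt0: "\<theta> p < \<theta> j" by (simp add: \<theta>_iff)
    have "\<theta> j - \<theta> p \<le> cubic_entry x i j k" if k: "k \<in> {1..r}" and "cubic_entry x i j k > 0" for i k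
    proof (rule ccontr)
      \<comment> \<open>A smaller positive entry would have integer part m = 0, since all shift
        differences lie in (-1,1). Then i lies between p and j in preorder, and \<open>key\<close>
        gives m at most -k.\<close>
      define m where "m = K j - K i - int k + of_bool (j < i)"
      assume less: "\<not> \<theta> j - \<theta> p \<le> cubic_entry x i j k"
      have "i \<noteq> j" using that(2) by (auto simp: cubic_entry_def)
      then have e: "cubic_entry x i j k = of_int m + (\<theta> j - \<theta> i)" by (simp add: entry m_def)
      have "-1 < m" "m < 1"
        using that(2) less e \<theta>_bounds[of i] \<theta>_bounds[of j] \<theta>_bounds[of p] by linarith+
      then have "m = 0" by simp
      with less e that(2) have "\<theta> i < \<theta> j" "\<theta> p < \<theta> i" by auto
      from key[OF this(1)] this(2) P have "K j + of_bool (j < i) \<le> K i" by auto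
      with \<open>m = 0\<close> k show False by (auto simp: m_def)
    qed
    then have "min_pos_at r x j (p, q)"
      using label[OF P] gt0 pos by (auto simp: min_pos_at_def)
    then show ?thesis using P by (simp add: pq_eq_Some_iff[OF gen])
  qed
  with gen show thesis using that by blast
qed

end

section \<open>The tree of a labelled forest\<close>

text \<open>Separated from \<open>shi_f\<close> so that lists obtained from an arbitrary rooted tree
  can be treated in the same way.\<close>

definition forest_tree :: "('n \<Rightarrow> 'n vertex list) \<Rightarrow> 'n vertex set set" where
  "forest_tree f = (\<Union>j. {{u, w} | u w. u \<noteq> w \<and> u \<in> insert (Vv j) (set (f j))
                                          \<and> w \<in> insert (Vv j) (set (f j))})"

lemma shi_tree_eq_forest_tree: "shi_tree r x = forest_tree (shi_f r x)"
  by (simp add: shi_tree_def forest_tree_def shi_F_def)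

lemma O_set_simps [simp]: "finite (O_set r)" "card (O_set r) = r" "Ov k \<in> O_set r \<longleftrightarrow> k \<in> {1..r}"
  "Vv j \<notin> O_set r" "set (map Ov [1..<Suc r]) = O_set r"
  by (auto simp: O_set_def card_image inj_on_def)

lemma set_remove_nth:
  assumes "distinct xs" "1 \<le> k" "k \<le> length xs"
  shows "set (take (k - 1) xs @ drop k xs) = set xs - {xs ! (k - 1)}"
proof -
  have xs: "xs = take (k - 1) xs @ xs ! (k - 1) # drop k xs"
    using id_take_nth_drop[of "k - 1" xs] assms by simp
  with assms(1) have "distinct (take (k - 1) xs @ xs ! (k - 1) # drop k xs)" by metis
  then have "xs ! (k - 1) \<notin> set (take (k - 1) xs @ drop k xs)" by auto
  moreover have "set xs = insert (xs ! (k - 1)) (set (take (k - 1) xs @ drop k xs))"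
    by (subst xs) auto
  ultimately show ?thesis by auto
qed

text \<open>Injectivity makes \<open>D\<close> a linear order of the vertices, from which a valid
  rearrangement is read off.\<close>

locale clique_forest = labelled_forest r P D
  for r :: nat and P :: "'n::{finite,linorder} \<Rightarrow> ('n \<times> nat) option" and D :: "'n \<Rightarrow> nat" +
  fixes f :: "'n \<Rightarrow> 'n vertex list"
  assumes f_rec: "f j = (case P j of None \<Rightarrow> map Ov [1..<Suc r]
      | Some (p, q) \<Rightarrow> take (q - 1) (f p) @ drop q (f p) @ [Vv p])"
    and inj_D: "inj D"
begin

lemma f_None: "P j = None \<Longrightarrow> f j = map Ov [1..<Suc r]"
  by (simp add: f_rec[of j])

lemma f_Some: "P j = Some (p, q) \<Longrightarrow> f j = take (q - 1) (f p) @ drop q (f p) @ [Vv p]"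
  by (simp add: f_rec[of j])

lemma f_induct [case_names root child]:
  assumes "\<And>j. P j = None \<Longrightarrow> Q j"
    and "\<And>j p q. P j = Some (p, q) \<Longrightarrow> Q p \<Longrightarrow> Q j"
  shows "Q j"
proof (induction "D j" arbitrary: j rule: less_induct)
  case less
  show ?case
  proof (cases "P j")
    case (Some u)
    then have "P j = Some (fst u, snd u)" by simp
    then show ?thesis using assms(2) above less by blast
  qed (rule assms(1))
qed

lemma length_f: "length (f j) = r"
proof (induction j rule: f_induct)
  case (child j p q)
  with label[of j p q] show ?case by (auto simp: f_Some)
qed (simp add: f_None)

lemma set_f_Some:
  assumes "P j = Some (p, q)"
  shows "set (f j) \<subseteq> insert (Vv p) (set (f p))"
  using assms by (auto simp: f_Some dest: in_set_takeD in_set_dropD)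

lemma Vv_in_f: "P j = Some (p, q) \<Longrightarrow> Vv p \<in> set (f j)"
  by (simp add: f_Some)

lemma f_root_iff: "P j = None \<longleftrightarrow> set (f j) = O_set r"
proof (cases "P j")
  case None
  then show ?thesis unfolding f_None[OF None] O_set_simps by simp
next
  case (Some u)
  then show ?thesis using Vv_in_f[of j "fst u" "snd u"] by auto
qed

lemma set_f_above: "Vv u \<in> set (f j) \<Longrightarrow> D u < D j"
proof (induction j rule: f_induct)
  case (child j p q)
  then show ?case using set_f_Some[OF child(1)] above[OF child(1)] by fastforce
qed (auto simp: f_root_iff)

lemma set_f_O: "Ov k \<in> set (f j) \<Longrightarrow> k \<in> {1..r}"
proof (induction j rule: f_induct)
  case (child j p q)
  then show ?case using set_f_Some[OF child(1)] by blast
qed (auto simp: f_root_iff)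

lemma distinct_f: "distinct (f j)"
proof (induction j rule: f_induct)
  case (root j)
  then show ?case by (auto simp: f_None distinct_map inj_on_def)
next
  case (child j p q)
  have "set (take (q - 1) (f p)) \<inter> set (drop q (f p)) = {}"
    using child(2) by (intro set_take_disj_set_drop_if_distinct) auto
  moreover have "Vv p \<notin> set (f p)" using set_f_above by blast
  ultimately show ?case
    using child by (auto simp: f_Some dest: in_set_takeD in_set_dropD)
qed

lemma card_set_f: "card (set (f j)) = r"
  using distinct_f[of j] length_f[of j] distinct_card by metis

lemma is_clique_f: "is_clique (r + 1) (forest_tree f) (insert (Vv j) (set (f j)))"
proof -
  have "Vv j \<notin> set (f j)" using set_f_above by blast
  then show ?thesis
    by (auto simp: is_clique_def card_set_f mutually_adjacent_def forest_tree_def)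
qed

text \<open>Climbing from l to its parent keeps both vertices in the list until one of them is the
  parent p itself; the other then belongs to \<open>f p\<close>.\<close>

lemma f_descend:
  assumes "Vv j \<in> set (f l)" "w \<in> set (f l)" "w \<noteq> Vv j"
  shows "w \<in> set (f j) \<or> (\<exists>u. w = Vv u \<and> Vv j \<in> set (f u))"
  using assms
proof (induction l rule: f_induct)
  case (child l p q)
  then show ?case using set_f_Some[OF child(1)] by (cases "Vv j = Vv p"; cases "w = Vv p") auto
qed (simp add: f_root_iff)

text \<open>By \<open>f_descend\<close>, later cliques add no edge at \<open>Vv j\<close> beyond
  those joining a vertex to a member of its own list.\<close>

lemma forest_tree_adj:
  "{Vv j, w} \<in> forest_tree f \<longleftrightarrow> w \<in> set (f j) \<or> (\<exists>u. w = Vv u \<and> Vv j \<in> set (f u))"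
    (is "?L \<longleftrightarrow> ?R")
proof
  assume ?L
  then obtain l u v where "{Vv j, w} = {u, v}" "u \<noteq> v"
      "u \<in> insert (Vv l) (set (f l))" "v \<in> insert (Vv l) (set (f l))"
    unfolding forest_tree_def by blast
  then have "w \<noteq> Vv j" "Vv j \<in> insert (Vv l) (set (f l))" "w \<in> insert (Vv l) (set (f l))"
    by (auto simp: doubleton_eq_iff)
  then show ?R using f_descend[of j l w] by auto
next
  assume R: ?R
  have "{Vv a, b} \<in> forest_tree f" if "b \<in> set (f a)" for a b
  proof -
    have "Vv a \<noteq> b" using that set_f_above[of a a] by auto
    with is_clique_f[of a] that show ?thesis by (simp add: is_clique_def mutually_adjacent_def)
  qed
  with R show ?L by (metis insert_commute)
qed

lemma forest_tree_earlier:
  assumes "w \<in> O_set r \<union> Vv ` {u. D u < D j}"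
  shows "{Vv j, w} \<in> forest_tree f \<longleftrightarrow> w \<in> set (f j)"
  using assms unfolding forest_tree_adj by (auto dest: set_f_above)

lemma set_f_subset: "set (f j) \<subseteq> O_set r \<union> Vv ` {u. D u < D j}"
proof
  fix w assume "w \<in> set (f j)"
  then show "w \<in> O_set r \<union> Vv ` {u. D u < D j}"
    by (cases w rule: vertex.exhaust) (auto dest: set_f_above set_f_O)
qed

text \<open>Sorting by \<open>D\<close> puts every vertex after the members of its list, which are
  then exactly its earlier neighbours.\<close>

lemma valid_rearrangement_f:
  obtains vs where "valid_rearrangement r (forest_tree f) vs"
proof -
  define vs where "vs = sort_key D (sorted_list_of_set (UNIV :: 'n set))"
  have vs: "distinct vs" "set vs = UNIV" by (auto simp: vs_def)
  have "sorted (map D vs)" by (simp add: vs_def)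
  then have "sorted_wrt (<) (map D vs)"
    using vs(1) inj_D by (simp add: strict_sorted_iff distinct_map inj_on_def)
  then have mono: "D (vs ! a) < D (vs ! b) \<longleftrightarrow> a < b" if "a < length vs" "b < length vs" for a b
    using that by (metis length_map linorder_neqE_nat not_less_iff_gr_or_eq nth_map sorted_wrt_iff_nth_less)
  have "valid_rearrangement r (forest_tree f) vs"
    unfolding valid_rearrangement_def Let_def
  proof (intro conjI allI impI vs)
    fix a assume a: "a < length vs"
    have "set (take a vs) = {u. D u < D (vs ! a)}"
    proof (intro equalityI subsetI)
      fix u assume "u \<in> set (take a vs)"
      then obtain b where "b < a" "u = vs ! b" by (auto simp: in_set_conv_nth)
      then show "u \<in> {u. D u < D (vs ! a)}" using mono a by auto
    next
      fix u assume u: "u \<in> {u. D u < D (vs ! a)}"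
      obtain b where "b < length vs" "u = vs ! b" using vs(2) by (metis UNIV_I in_set_conv_nth)
      with u mono a show "u \<in> set (take a vs)" by (auto simp: in_set_conv_nth)
    qed
    then have N: "{u \<in> O_set r \<union> Vv ` set (take a vs). {Vv (vs ! a), u} \<in> forest_tree f} = set (f (vs ! a))"
      using forest_tree_earlier[of _ "vs ! a"] set_f_subset[of "vs ! a"] by auto
    show "card {u \<in> O_set r \<union> Vv ` set (take a vs). {Vv (vs ! a), u} \<in> forest_tree f} = r"
      unfolding N by (rule card_set_f)
    show "mutually_adjacent (forest_tree f)
        {u \<in> O_set r \<union> Vv ` set (take a vs). {Vv (vs ! a), u} \<in> forest_tree f}"
      unfolding N using is_clique_f[of "vs ! a"] by (auto simp: is_clique_def mutually_adjacent_def)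
  qed
  then show thesis by (rule that)
qed

lemma forest_tree_in_rooted_r_trees: "forest_tree f \<in> rooted_r_trees r"
proof -
  have "insert (Vv j) (set (f j)) \<subseteq> O_set r \<union> V_set" for j
    using set_f_subset[of j] by (auto simp: V_set_def)
  then have "graph_on (O_set r \<union> V_set) (forest_tree f)"
    unfolding graph_on_def forest_tree_def by (fastforce simp: card_2_iff)
  then show ?thesis
    unfolding rooted_r_trees_def using valid_rearrangement_f by blast
qed

end

text \<open>First the graph determines the sets F(v_j), by induction on \<open>D\<close> although
  the two forests may have different measures; then labels and lists are recovered from the roots
  downwards.\<close>

lemma forest_tree_inj:
  assumes "clique_forest r P D f" "clique_forest r P' D' f'" and eq: "forest_tree f = forest_tree f'"
  shows "P = P'"
proof -
  interpret A: clique_forest r P D f by fact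
  interpret B: clique_forest r P' D' f' by fact
  have F: "set (f j) = set (f' j)" for j
  proof (induction "D j" arbitrary: j rule: less_induct)
    case less
    have "w \<in> set (f' j)" if w: "w \<in> set (f j)" for w
    proof (rule ccontr)
      assume "w \<notin> set (f' j)"
      \<comment> \<open>Here u is below j in \<open>D\<close>, so the induction hypothesis moves j
        into \<open>f u\<close>, contradicting the order.\<close>
      then obtain u where "w = Vv u" "Vv j \<in> set (f' u)"
        using A.forest_tree_adj[of j w] B.forest_tree_adj[of j w] w eq by auto
      then show False using less[of u] A.set_f_above w by (metis less_asym)
    qed
    then show ?case
      by (metis A.card_set_f B.card_set_f List.finite_set card_subset_eq subsetI)
  qed
  have "P j = P' j \<and> f j = f' j" for j
  proof (induction j rule: A.f_induct)
    case (root j)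
    then show ?case using F A.f_root_iff B.f_root_iff A.f_None B.f_None by metis
  next
    case (child j p q)
    then have "P' j \<noteq> None" using F A.f_root_iff B.f_root_iff by (metis option.distinct(1))
    then obtain p' q' where P': "P' j = Some (p', q')" by auto
    \<comment> \<open>Distinct parents would each belong to the list of the other, against the order
      by \<open>D\<close>.\<close>
    have "p' = p"
    proof (rule ccontr)
      assume "p' \<noteq> p"
      have "Vv p' \<in> set (f j)" "Vv p \<in> set (f' j)"
        using A.Vv_in_f[OF child(1)] B.Vv_in_f[OF P'] F by auto
      then have "Vv p' \<in> set (f p)" "Vv p \<in> set (f' p')"
        using A.set_f_Some[OF child(1)] B.set_f_Some[OF P'] \<open>p' \<noteq> p\<close> by auto
      then show False using A.set_f_above F by (metis less_asym)
    qed
    have q: "q \<in> {1..r}" "q' \<in> {1..r}" using A.label[OF child(1)] B.label[OF P'] by auto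
    have ff: "f p = f' p" using child by simp
    have miss: "set (take (k - 1) (f p) @ drop k (f p)) = set (f p) - {f p ! (k - 1)}"
      if "k \<in> {1..r}" for k
      by (rule set_remove_nth) (use that A.length_f A.distinct_f in auto)
    \<comment> \<open>Apart from p, the set F(v_j) lacks a single member of \<open>f p\<close>; its
      position reveals q.\<close>
    have "set (f j) - {Vv p} = set (f p) - {f p ! (q - 1)}"
      "set (f' j) - {Vv p} = set (f p) - {f p ! (q' - 1)}"
      using A.f_Some[OF child(1)] B.f_Some[OF P'] miss[OF q(1)] miss[OF q(2)] ff \<open>p' = p\<close>
        A.set_f_above[of p p] by auto
    then have "set (f p) - {f p ! (q - 1)} = set (f p) - {f p ! (q' - 1)}"
      using F by simp
    moreover have "f p ! (q - 1) \<in> set (f p)" using q A.length_f[of p] by auto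
    ultimately have "f p ! (q - 1) = f p ! (q' - 1)" by blast
    then have "q = q'"
      using A.distinct_f[of p] A.length_f[of p] q by (auto simp: nth_eq_iff_index_eq)
    with \<open>p' = p\<close> P' child ff show ?case by (simp add: A.f_Some B.f_Some)
  qed
  then show ?thesis by auto
qed

section \<open>The forest of a rooted tree\<close>

text \<open>Allowing different measures matters: one list comes from the ranks of a point, the other
  from a rearrangement of a given tree.\<close>

lemma clique_forest_unique:
  assumes "clique_forest r P D f" "clique_forest r P D' f'"
  shows "f' = f"
proof
  interpret A: clique_forest r P D f by fact
  interpret B: clique_forest r P D' f' by fact
  fix j show "f' j = f j"
    by (induction j rule: A.f_induct) (simp_all add: A.f_None B.f_None A.f_Some B.f_Some del: upt_Suc)
qed

text \<open>Let \<open>D\<close> be the position in a valid rearrangement and \<open>f j\<close> the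
  earlier neighbours of j in order of appearance. If the last of them is a vertex p of V, the other
  r - 1 are earlier neighbours of p, so exactly one member of \<open>f p\<close> is dropped.\<close>

lemma rooted_r_tree_forest:
  fixes T :: "'n::{finite,linorder} vertex set set"
  assumes "r \<ge> 1" "T \<in> rooted_r_trees r"
  obtains P D f where "clique_forest r P D f" "forest_tree f = T"
proof -
  obtain vs where graph: "graph_on (O_set r \<union> V_set) T" and "valid_rearrangement r T vs"
    using assms(2) by (auto simp: rooted_r_trees_def)
  then have vs: "distinct vs" "set vs = UNIV"
    and valid: "\<And>a. a < length vs \<Longrightarrow>
      card {u \<in> O_set r \<union> Vv ` set (take a vs). {Vv (vs ! a), u} \<in> T} = r \<and>
      mutually_adjacent T {u \<in> O_set r \<union> Vv ` set (take a vs). {Vv (vs ! a), u} \<in> T}"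
    by (auto simp: valid_rearrangement_def Let_def)
  have bij: "bij_betw ((!) vs) {..<length vs} UNIV"
    using bij_betw_nth[OF vs(1), of "{..<length vs}" UNIV] vs(2) by simp
  define D where "D = the_inv_into {..<length vs} ((!) vs)"
  have D_lt: "D j < length vs" and nth_D: "vs ! D j = j" for j
    using bij unfolding D_def bij_betw_def
    by (metis UNIV_I lessThan_iff order_refl the_inv_into_into, metis UNIV_I f_the_inv_into_f)
  have D_nth: "D (vs ! a) = a" if "a < length vs" for a
    using that bij unfolding D_def bij_betw_def by (simp add: the_inv_into_f_f)
  have inj_D: "inj D" by (metis injI nth_D)
  define N where "N j = {w \<in> O_set r \<union> Vv ` {u. D u < D j}. {Vv j, w} \<in> T}" for j
  have take_D: "set (take (D j) vs) = {u. D u < D j}" for j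
  proof (intro equalityI subsetI)
    fix u assume "u \<in> set (take (D j) vs)"
    then obtain b where "b < D j" "u = vs ! b" by (auto simp: in_set_conv_nth)
    then show "u \<in> {u. D u < D j}" using D_lt[of j] by (simp add: D_nth)
  next
    fix u assume "u \<in> {u. D u < D j}"
    then show "u \<in> set (take (D j) vs)" using nth_D[of u] D_lt[of j] D_lt[of u]
      by (auto simp: in_set_conv_nth intro!: exI[of _ "D u"])
  qed
  have card_N: "card (N j) = r" and adj_N: "mutually_adjacent T (N j)" for j
    using valid[OF D_lt[of j]] unfolding take_D nth_D N_def by auto
  have fin_N: "finite (N j)" for j unfolding N_def by auto
  define W :: "'n vertex set" where "W = O_set r \<union> V_set"
  \<comment> \<open>Order of appearance: o_1, ..., o_r first, and the offset r + 1 keeps all of V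
    behind them.\<close>
  define \<rho> where "\<rho> w = (case w of Ov k \<Rightarrow> k | Vv u \<Rightarrow> r + 1 + D u)" for w :: "'n vertex"
  have \<rho>_simps [simp]: "\<rho> (Ov k) = k" "\<rho> (Vv u) = r + 1 + D u" for k u
    by (simp_all add: \<rho>_def)
  have N_W: "N j \<subseteq> W" for j by (auto simp: N_def W_def V_set_def)
  have inj_\<rho>: "inj_on \<rho> W"
    using inj_D by (auto simp: W_def inj_on_def O_set_def V_set_def)
  have unique: "xs = ys"
    if "set xs = set ys" "set ys \<subseteq> W" "sorted (map \<rho> xs)" "distinct xs" "sorted (map \<rho> ys)" "distinct ys"
    for xs ys
    using that inj_on_subset[OF inj_\<rho>, of "set ys"]
    by (intro map_sorted_distinct_set_unique[of \<rho>]) (auto simp: distinct_map)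
  have "\<exists>l. set l = N j \<and> distinct l \<and> sorted (map \<rho> l)" for j
  proof -
    obtain l where "set l = N j" "distinct l" using finite_distinct_list[OF fin_N] by blast
    then show ?thesis by (intro exI[of _ "sort_key \<rho> l"]) auto
  qed
  then obtain f where f: "set (f j) = N j" "distinct (f j)" "sorted (map \<rho> (f j))" for j
    by metis
  have len_f: "length (f j) = r" for j
    using card_N[of j] f(1,2)[of j] distinct_card by metis
  have root: "f j = map Ov [1..<Suc r]" if "N j = O_set r" for j
  proof (rule unique)
    show "set (f j) = set (map Ov [1..<Suc r])" unfolding f(1) O_set_simps by (rule that)
    show "set (map Ov [1..<Suc r]) \<subseteq> W" unfolding O_set_simps W_def by blast
  qed (use f in \<open>auto simp: distinct_map inj_on_def comp_def simp del: upt_Suc\<close>)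
  have "\<exists>p q. D p < D j \<and> q \<in> {1..r} \<and> f j = take (q - 1) (f p) @ drop q (f p) @ [Vv p]"
    if "N j \<noteq> O_set r" for j
  proof -
    have "\<not> N j \<subseteq> O_set r" using that card_N[of j] card_subset_eq[of "O_set r" "N j"] by auto
    then obtain u where u: "Vv u \<in> N j" by (auto simp: N_def)
    have "f j \<noteq> []" using u f(1)[of j] by auto
    then obtain xs w where xs: "f j = xs @ [w]" by (metis rev_exhaust)
    have w: "w \<in> N j" "w \<notin> set xs" "\<And>z. z \<in> set xs \<Longrightarrow> \<rho> z \<le> \<rho> w"
      using f[of j] unfolding xs by (auto simp: sorted_append)
    have "\<rho> (Vv u) \<le> \<rho> w" using u f(1)[of j] w(3)[of "Vv u"] unfolding xs by (cases "Vv u = w") auto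
    then obtain p where p: "w = Vv p" "D p < D j"
      using w(1) by (cases w rule: vertex.exhaust) (auto simp: N_def)
    \<comment> \<open>The earlier neighbours of j form a clique, and all others in it appear before
      p.\<close>
    have sub: "set xs \<subseteq> N p"
    proof
      fix z assume z: "z \<in> set xs"
      then have "z \<in> N j" "z \<noteq> Vv p" using f(1)[of j] w(2) p(1) unfolding xs by auto
      then have "{Vv p, z} \<in> T" using adj_N[of j] w(1) p(1) by (simp add: mutually_adjacent_def)
      moreover have "D v < D p" if "z = Vv v" for v
        using w(3)[OF z] that p(1) \<open>z \<noteq> Vv p\<close> inj_D by (auto simp: inj_def le_less)
      ultimately show "z \<in> N p"
        using \<open>z \<in> N j\<close> by (cases z rule: vertex.exhaust) (auto simp: N_def)
    qed
    have card_xs: "card (set xs) = r - 1"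
      using f(2)[of j] len_f[of j] unfolding xs by (auto simp: distinct_card)
    have "card (N p - set xs) = 1"
      using card_Diff_subset[OF _ sub] card_N[of p] card_xs assms(1) by simp
    then obtain y where y: "N p - set xs = {y}" by (auto simp: card_1_singleton_iff)
    then have "y \<in> set (f p)" using f(1) by auto
    then obtain as bs where split: "f p = as @ y # bs" by (auto dest: split_list)
    \<comment> \<open>Deleting y preserves the order, and a list sorted by the injective key \<rho>
      is determined by its set.\<close>
    have "as @ bs = xs"
    proof (rule unique)
      show "set (as @ bs) = set xs" using f(1,2)[of p] y sub unfolding split by auto
      show "set xs \<subseteq> W" using sub N_W by blast
    qed (use f(2,3)[of p] f(2,3)[of j] in \<open>auto simp: split xs sorted_append\<close>)
    then have "f j = take (Suc (length as) - 1) (f p) @ drop (Suc (length as)) (f p) @ [Vv p]"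
      by (simp add: xs split p(1))
    moreover have "Suc (length as) \<in> {1..r}" using len_f[of p] by (simp add: split)
    ultimately show ?thesis using p(2) by blast
  qed
  then obtain p q where pq: "N j \<noteq> O_set r \<Longrightarrow> D (p j) < D j \<and> q j \<in> {1..r} \<and>
      f j = take (q j - 1) (f (p j)) @ drop (q j) (f (p j)) @ [Vv (p j)]" for j
    by metis
  define P where "P j = (if N j = O_set r then None else Some (p j, q j))" for j
  have "clique_forest r P D f"
  proof
    fix j a b assume "P j = Some (a, b)"
    then show "b \<in> {1..r}" "D a < D j" using pq[of j] by (auto simp: P_def split: if_splits)
  next
    fix j show "f j = (case P j of None \<Rightarrow> map Ov [1..<Suc r]
      | Some (p, q) \<Rightarrow> take (q - 1) (f p) @ drop q (f p) @ [Vv p])"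
      using pq[of j] root[of j] by (simp add: P_def del: upt_Suc)
  qed (rule inj_D)
  then interpret clique_forest r P D f .
  have "forest_tree f = T"
  proof (intro equalityI subsetI)
    fix E assume "E \<in> forest_tree f"
    then obtain j u w where "E = {u, w}" "u \<noteq> w" "u \<in> insert (Vv j) (N j)" "w \<in> insert (Vv j) (N j)"
      unfolding forest_tree_def f(1) by blast
    moreover have "{Vv j, z} \<in> T" if "z \<in> N j" for z using that by (simp add: N_def)
    ultimately show "E \<in> T"
      using adj_N[of j] unfolding mutually_adjacent_def by (metis insert_commute insert_iff)
  next
    fix E assume "E \<in> T"
    then have "E \<subseteq> O_set r \<union> V_set" "card E = 2" using graph by (auto simp: graph_on_def)
    then obtain u w where E: "E = {u, w}" "u \<noteq> w" "u \<in> O_set r \<union> V_set" "w \<in> O_set r \<union> V_set"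
      by (auto simp: card_2_iff)
    have edge: "{Vv a, z} \<in> forest_tree f"
      if "{Vv a, z} \<in> T" "z \<in> O_set r \<union> Vv ` {v. D v < D a}" for a z
      using that forest_tree_earlier[OF that(2)] f(1) by (simp add: N_def)
    \<comment> \<open>An edge with an endpoint in V is seen from its later endpoint.\<close>
    have VO: "{Vv a, z} \<in> forest_tree f" if z: "{Vv a, z} \<in> T" "z \<in> O_set r \<union> V_set" "Vv a \<noteq> z" for a z
    proof (cases "z \<in> O_set r \<union> Vv ` {v. D v < D a}")
      case True
      then show ?thesis using edge z by blast
    next
      case False
      then obtain v where "z = Vv v" "\<not> D v < D a" using z(2) by (auto simp: V_set_def)
      moreover from this z(3) have "D a < D v"
        using inj_D by (metis injD linorder_neqE_nat)
      ultimately show ?thesis using edge[of v "Vv a"] z(1) by (simp add: insert_commute)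
    qed
    show "E \<in> forest_tree f"
    proof (cases "u \<in> O_set r \<and> w \<in> O_set r")
      case True
      \<comment> \<open>Edges inside O: the first vertex of the rearrangement has only O before it,
        so its r earlier neighbours are all of O.\<close>
      define j where "j = vs ! 0"
      have "vs \<noteq> []" using vs(2) by auto
      then have "D j = 0" unfolding j_def by (intro D_nth) simp
      then have "N j \<subseteq> O_set r" by (auto simp: N_def)
      then have "N j = O_set r" using card_N[of j] by (intro card_subset_eq) auto
      then have "u \<in> set (f j)" "w \<in> set (f j)" using True f(1) by auto
      then show ?thesis unfolding forest_tree_def E(1) using E(2) by blast
    next
      case False
      then show ?thesis using VO E \<open>E \<in> T\<close> by (auto simp: V_set_def insert_commute)
    qed
  qed
  with \<open>clique_forest r P D f\<close> show thesis by (rule that)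
qed

section \<open>The forest of a point and the bijection\<close>

lemma shi_f_dom_generic:
  assumes "x \<in> shi_generic r"
  shows "shi_f_dom (r, x, j)"
proof (induction "rank_above x j" arbitrary: j rule: less_induct)
  case less
  show ?case
    by (rule shi_f.domintros) (blast intro: less pq_Some_D(3)[OF assms])+
qed

lemma clique_forest_shi:
  assumes "r \<ge> 1" "x \<in> shi_generic r"
  shows "clique_forest r (pq r x) (rank_above x) (shi_f r x)"
proof
  show "inj (rank_above x)"
  proof (rule injI)
    fix i j assume "rank_above x i = rank_above x j"
    then have "\<not> x $ i < x $ j" "\<not> x $ j < x $ i" by (simp_all flip: rank_above_less_iff)
    then show "i = j" using shi_generic_neq[OF assms(2,1), of i j] by force
  qed
qed (use pq_Some_D[OF assms(2)] shi_f.psimps[OF shi_f_dom_generic[OF assms(2)]] in blast)+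

theorem theorem2p2:
  fixes r :: nat
  assumes "r \<ge> 1"
  shows "(\<forall>\<Delta>\<in>(shi_regions r :: (real ^ 'n::{finite,linorder}) set set). \<forall>x\<in>\<Delta>.
            (\<forall>j. \<not> col_nonpos r x j \<longrightarrow> (\<exists>!u. min_pos_at r x j u)) \<and>
            (\<forall>j. shi_f_dom (r, x, j)) \<and>
            (\<forall>j. is_clique (r + 1) (shi_tree r x) (insert (Vv j) (shi_F r x j))) \<and>
            shi_tree r x \<in> rooted_r_trees r \<and>
            (\<forall>y\<in>\<Delta>. shi_tree r y = shi_tree r x) \<and>
            Psi r \<Delta> = shi_tree r x) \<and>
         bij_betw (Psi r) (shi_regions r :: (real ^ 'n::{finite,linorder}) set set) (rooted_r_trees r)"
proof -
  \<comment> \<open>One direction yields independence of the point chosen in \<Delta>, the other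
    injectivity of \<open>Psi\<close>.\<close>
  have tree_eq_iff: "shi_tree r x = shi_tree r y \<longleftrightarrow> same_side r x y"
    if xy: "x \<in> shi_generic r" "y \<in> shi_generic r" for x y :: "real ^ 'n::{finite,linorder}"
  proof
    interpret A: clique_forest r "pq r x" "rank_above x" "shi_f r x"
      using assms xy by (intro clique_forest_shi)
    interpret B: clique_forest r "pq r y" "rank_above y" "shi_f r y"
      using assms xy by (intro clique_forest_shi)
    assume "shi_tree r x = shi_tree r y"
    then have "pq r x = pq r y"
      using forest_tree_inj[OF A.clique_forest_axioms B.clique_forest_axioms]
      by (simp add: shi_tree_eq_forest_tree)
    with xy show "same_side r x y" by (intro pq_determines_same_side)
  next
    assume "same_side r x y"
    with xy have eq: "pq r x = pq r y" by (intro same_side_pq)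
    interpret A: clique_forest r "pq r x" "rank_above x" "shi_f r x"
      using assms xy by (intro clique_forest_shi)
    interpret B: clique_forest r "pq r y" "rank_above y" "shi_f r y"
      using assms xy by (intro clique_forest_shi)
    have "shi_f r x = shi_f r y"
      using clique_forest_unique[OF A.clique_forest_axioms] B.clique_forest_axioms by (simp add: eq)
    then show "shi_tree r x = shi_tree r y" by (simp add: shi_tree_eq_forest_tree)
  qed
  have main: "(\<forall>j. \<not> col_nonpos r x j \<longrightarrow> (\<exists>!u. min_pos_at r x j u)) \<and>
      (\<forall>j. shi_f_dom (r, x, j)) \<and>
      (\<forall>j. is_clique (r + 1) (shi_tree r x) (insert (Vv j) (shi_F r x j))) \<and>
      shi_tree r x \<in> rooted_r_trees r \<and>
      (\<forall>y\<in>\<Delta>. shi_tree r y = shi_tree r x) \<and>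
      Psi r \<Delta> = shi_tree r x" if \<Delta>: "\<Delta> \<in> shi_regions r" "x \<in> \<Delta>" for \<Delta> and x :: "real ^ 'n::{finite,linorder}"
  proof -
    have gen: "x \<in> shi_generic r" using \<Delta> shi_region_subset by blast
    interpret clique_forest r "pq r x" "rank_above x" "shi_f r x"
      using assms gen by (intro clique_forest_shi)
    have const: "shi_tree r y = shi_tree r x" if "y \<in> \<Delta>" for y
      using tree_eq_iff shi_region_same_side[OF \<Delta>(1)] that \<Delta> shi_region_subset[OF \<Delta>(1)] by blast
    moreover have "Psi r \<Delta> = shi_tree r x"
      unfolding Psi_def by (rule const) (use \<Delta>(2) in \<open>rule someI\<close>)
    ultimately show ?thesis
      using ex1_min_pos_at[OF gen] shi_f_dom_generic[OF gen] is_clique_f forest_tree_in_rooted_r_trees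
      by (simp add: shi_tree_eq_forest_tree shi_F_def)
  qed
  have Psi: "Psi r \<Delta> = shi_tree r x" "shi_tree r x \<in> rooted_r_trees r"
    if "\<Delta> \<in> shi_regions r" "x \<in> \<Delta>" for \<Delta> and x :: "real ^ 'n::{finite,linorder}"
    using main[OF that] by blast+
  have "bij_betw (Psi r) (shi_regions r :: (real ^ 'n::{finite,linorder}) set set) (rooted_r_trees r)"
    unfolding bij_betw_def
  proof
    show "inj_on (Psi r) (shi_regions r :: (real ^ 'n::{finite,linorder}) set set)"
    proof (rule inj_onI)
      fix \<Delta> \<Delta>' :: "(real ^ 'n::{finite,linorder}) set"
      assume \<Delta>: "\<Delta> \<in> shi_regions r" "\<Delta>' \<in> shi_regions r" "Psi r \<Delta> = Psi r \<Delta>'"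
      obtain x y where xy: "x \<in> \<Delta>" "y \<in> \<Delta>'" using \<Delta>(1,2) shi_region_nonempty by blast
      then have "shi_tree r x = shi_tree r y" using Psi(1)[OF \<Delta>(1)] Psi(1)[OF \<Delta>(2)] \<Delta>(3) by simp
      moreover have "x \<in> shi_generic r" "y \<in> shi_generic r"
        using xy shi_region_subset[OF \<Delta>(1)] shi_region_subset[OF \<Delta>(2)] by blast+
      ultimately have "same_side r x y" using tree_eq_iff by blast
      then show "\<Delta> = \<Delta>'" using shi_region_eqI \<Delta>(1,2) xy by blast
    qed
    show "Psi r ` shi_regions r = (rooted_r_trees r :: 'n vertex set set set)"
    proof (intro equalityI subsetI)
      fix T :: "'n vertex set set"
      assume "T \<in> Psi r ` shi_regions r"
      then obtain \<Delta> :: "(real ^ 'n::{finite,linorder}) set" where "\<Delta> \<in> shi_regions r" "T = Psi r \<Delta>" by blast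
      then show "T \<in> rooted_r_trees r" using Psi shi_region_nonempty by (metis ex_in_conv)
    next
      fix T :: "'n vertex set set"
      assume "T \<in> rooted_r_trees r"
      then obtain P D f where F: "clique_forest r P D f" "forest_tree f = T"
        using assms rooted_r_tree_forest by blast
      interpret clique_forest r P D f by fact
      \<comment> \<open>Surjectivity: the point realizes the forest of T, and the forest determines
        the lists and hence the tree.\<close>
      obtain x where x: "x \<in> shi_generic r" "pq r x = P" using realization by blast
      interpret X: clique_forest r "pq r x" "rank_above x" "shi_f r x"
        using assms x by (intro clique_forest_shi)
      have "shi_f r x = f"
        using clique_forest_unique[OF F(1)] X.clique_forest_axioms by (simp add: x(2))
      then have "shi_tree r x = T" by (simp add: shi_tree_eq_forest_tree F(2))
      moreover obtain \<Delta> where "\<Delta> \<in> shi_regions r" "x \<in> \<Delta>" using ex_shi_region[OF x(1)] .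
      ultimately show "T \<in> Psi r ` shi_regions r" using Psi(1) by blast
    qed
  qed
  with main show ?thesis by blast
qed

end
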